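(* Shift case: let $a_1(x),\ldots,a_n(x)\in\mathbb{C}(x)$ and let $z_1(x),\ldots,z_n(x)$ be functions meromorphic on $\mathbb{C}$ such that $z_i(x+1)-z_i(x)=a_i(x)$ for $i=1,\ldots,n$. Then $z_1(x),\ldots,z_n(x)$ are differentially dependent over $\mathcal{F}(x)$ if and only if there exists a nonzero homogeneous linear differential polynomial $L(Y_1,\ldots,Y_n)$ with coefficients in $\mathbb{C}$ such that $L(a_1(x),\ldots,a_n(x)) = g(x+1)-g(x)$ for some $g(x)\in\mathbb{C}(x)$. $q$-difference case: let $a_1(x),\ldots,a_n(x)\in\mathbb{C}(x)$ and let $z_1(x),\ldots,z_n(x)$ be functions meromorphic on $\mathbb{C}^*$ such that $z_i(qx)-z_i(x)=a_i(x)$ for $i=1,\ldots,n$. Then $z_1(x),\ldots,z_n(x)$ are differentially dependent over $\mathcal{G}(x)$ if and only if there exists a nonzero homogeneous linear differential polynomial $L(Y_1,\ldots,Y_n)$ with coefficients in $\mathbb{C}$ such that $L(a_1(x),\ldots,a_n(x)) = g(qx)-g(x)$ for some $g(x)\in\mathbb{C}(x)$.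
   Context: $\mathcal{F}$ is the field of $1$-periodic meromorphic functions, i.e. meromorphic functions $f$ on $\mathbb{C}$ with $f(x+1)=f(x)$. $q\in\mathbb{C}$ is nonzero with $|q|\neq 1$, and $\mathcal{G}$ is the field of functions $f$ meromorphic on $\mathbb{C}^*=\mathbb{C}\setminus\{0\}$ with $f(qx)=f(x)$. $\mathcal{F}(x)$ and $\mathcal{G}(x)$ are the fields generated over $\mathcal{F}$, resp. $\mathcal{G}$, by the function $x$. The derivation is $\partial=\frac{d}{dx}$ in the shift case and $\partial = x\frac{d}{dx}$ in the $q$-difference case. A homogeneous linear differential polynomial $L(Y_1,\ldots,Y_n)$ is a linear form in the variables $Y_i^{(j)}$, $j\ge0$; when elements $a_i$ are substituted for the $Y_i$, $Y_i^{(j)}$ is replaced by $\partial^j(a_i)$. Functions $z_1,\ldots,z_n$ are differentially dependent over a differential field $k$ if there is a nonzero differential polynomial $P\in k\{Y_1,\ldots,Y_n\}$ with $P(z_1,\ldots,z_n)=0$. *)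

theory Defs
  imports
    "HOL-Complex_Analysis.Complex_Analysis"
    "HOL-Library.Poly_Mapping"
    "HOL-Library.Function_Algebras"
begin

text \<open>
  A meromorphic function on an open set \<open>A\<close> is represented by any \<open>f\<close> with
  \<open>f meromorphic_on A\<close>; the values at poles are meaningless. Hence two representatives
  denote the same meromorphic function iff they agree on \<open>A\<close> up to a set without limit points
  in \<open>A\<close>, and every identity between meromorphic functions below is of the form
  \<open>\<forall>\<^sub>\<approx>x\<in>A. f x = g x\<close>. All sets of functions standing for the fields
  \<open>\<F>\<close>, \<open>\<G>\<close>, \<open>\<F>(x)\<close>, \<open>\<G>(x)\<close>
  are closed under this equality.
\<close>

definition periodic_field :: "(complex \<Rightarrow> complex) set" where
  "periodic_field = {f. f meromorphic_on UNIV \<and> (\<forall>\<^sub>\<approx>x\<in>UNIV. f (x + 1) = f x)}"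

definition q_periodic_field :: "complex \<Rightarrow> (complex \<Rightarrow> complex) set" where
  "q_periodic_field q = {f. f meromorphic_on (- {0}) \<and> (\<forall>\<^sub>\<approx>x\<in>- {0}. f (q * x) = f x)}"

text \<open>
  The field generated by a set \<open>S\<close> of meromorphic functions on \<open>A\<close>. The rule for inverses has no
  side condition: the pointwise inverse of a representative of zero again represents zero.
\<close>

inductive_set generated_field ::
    "complex set \<Rightarrow> (complex \<Rightarrow> complex) set \<Rightarrow> (complex \<Rightarrow> complex) set"
  for A :: "complex set" and S :: "(complex \<Rightarrow> complex) set" where
  generator: "f \<in> S \<Longrightarrow> f \<in> generated_field A S"
| one: "(\<lambda>x. 1) \<in> generated_field A S"
| diff: "f \<in> generated_field A S \<Longrightarrow> g \<in> generated_field A S \<Longrightarrow>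
    (\<lambda>x. f x - g x) \<in> generated_field A S"
| mult: "f \<in> generated_field A S \<Longrightarrow> g \<in> generated_field A S \<Longrightarrow>
    (\<lambda>x. f x * g x) \<in> generated_field A S"
| inverse: "f \<in> generated_field A S \<Longrightarrow> (\<lambda>x. inverse (f x)) \<in> generated_field A S"
| cong: "f \<in> generated_field A S \<Longrightarrow> (\<forall>\<^sub>\<approx>x\<in>A. g x = f x) \<Longrightarrow> g \<in> generated_field A S"

definition adjoin_x :: "complex set \<Rightarrow> (complex \<Rightarrow> complex) set \<Rightarrow> (complex \<Rightarrow> complex) set" where
  "adjoin_x A K = generated_field A (insert (\<lambda>x. x) K)"

definition rational_fun :: "(complex \<Rightarrow> complex) \<Rightarrow> bool" where
  "rational_fun f \<longleftrightarrow> (\<exists>p r :: complex poly. r \<noteq> 0 \<and> f = (\<lambda>x. poly p x / poly r x))"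

definition euler_deriv :: "(complex \<Rightarrow> complex) \<Rightarrow> complex \<Rightarrow> complex" where
  "euler_deriv f = (\<lambda>x. x * deriv f x)"

text \<open>
  The pair \<open>(i, j)\<close> stands for the variable \<open>Y\<^sub>i\<^sup>(\<^sup>j\<^sup>)\<close>, so a monomial is a finitely supported
  exponent map on such pairs and a differential polynomial is a finitely supported map from
  monomials to coefficients. As the coefficients are representatives of meromorphic functions,
  a differential polynomial is nonzero iff some coefficient is not almost everywhere zero,
  which is stronger than \<open>P \<noteq> 0\<close> in the type of finitely supported maps.
\<close>

type_synonym monomial = "(nat \<times> nat) \<Rightarrow>\<^sub>0 nat"

type_synonym diff_poly = "monomial \<Rightarrow>\<^sub>0 (complex \<Rightarrow> complex)"

definition diff_polys :: "(complex \<Rightarrow> complex) set \<Rightarrow> nat \<Rightarrow> diff_poly set" where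
  "diff_polys k n = {P. \<forall>m\<in>Poly_Mapping.keys P.
     Poly_Mapping.lookup P m \<in> k \<and> Poly_Mapping.keys m \<subseteq> {1..n} \<times> UNIV}"

definition diff_poly_nonzero :: "complex set \<Rightarrow> diff_poly \<Rightarrow> bool" where
  "diff_poly_nonzero A P \<longleftrightarrow> (\<exists>m. \<not> (\<forall>\<^sub>\<approx>x\<in>A. Poly_Mapping.lookup P m x = 0))"

definition eval_diff_poly ::
    "((complex \<Rightarrow> complex) \<Rightarrow> complex \<Rightarrow> complex) \<Rightarrow> diff_poly \<Rightarrow>
     (nat \<Rightarrow> complex \<Rightarrow> complex) \<Rightarrow> complex \<Rightarrow> complex" where
  "eval_diff_poly D P z x = (\<Sum>m\<in>Poly_Mapping.keys P. Poly_Mapping.lookup P m x *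
     (\<Prod>(i, j)\<in>Poly_Mapping.keys m. ((D ^^ j) (z i) x) ^ Poly_Mapping.lookup m (i, j)))"

definition diff_dependent ::
    "complex set \<Rightarrow> ((complex \<Rightarrow> complex) \<Rightarrow> complex \<Rightarrow> complex) \<Rightarrow>
     (complex \<Rightarrow> complex) set \<Rightarrow> nat \<Rightarrow> (nat \<Rightarrow> complex \<Rightarrow> complex) \<Rightarrow> bool" where
  "diff_dependent A D k n z \<longleftrightarrow>
     (\<exists>P\<in>diff_polys k n. diff_poly_nonzero A P \<and> (\<forall>\<^sub>\<approx>x\<in>A. eval_diff_poly D P z x = 0))"

text \<open>
  Homogeneous linear differential polynomials over the constants \<open>\<complex>\<close>: linear forms in the
  \<open>Y\<^sub>i\<^sup>(\<^sup>j\<^sup>)\<close>, given by their coefficients.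
\<close>

type_synonym linear_diff_poly = "(nat \<times> nat) \<Rightarrow>\<^sub>0 complex"

definition linear_diff_polys :: "nat \<Rightarrow> linear_diff_poly set" where
  "linear_diff_polys n = {L. Poly_Mapping.keys L \<subseteq> {1..n} \<times> UNIV}"

definition eval_linear_diff_poly ::
    "((complex \<Rightarrow> complex) \<Rightarrow> complex \<Rightarrow> complex) \<Rightarrow> linear_diff_poly \<Rightarrow>
     (nat \<Rightarrow> complex \<Rightarrow> complex) \<Rightarrow> complex \<Rightarrow> complex" where
  "eval_linear_diff_poly D L a x =
     (\<Sum>(i, j)\<in>Poly_Mapping.keys L. Poly_Mapping.lookup L (i, j) * (D ^^ j) (a i) x)"

end

theory Submission
  imports Defs
begin

text \<open>
  Write \<open>\<sigma>\<close> for the substitution \<open>x \<mapsto> x + 1\<close> or \<open>x \<mapsto> q x\<close>. Along an orbit \<open>\<sigma>\<^sup>n x\<^sub>0\<close>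
  a \<open>\<sigma>\<close>-invariant function is constant, so for all but countably many \<open>x\<^sub>0\<close> an element of
  \<open>\<F>(x)\<close> or \<open>\<G>(x)\<close> restricts to a rational function there. A differential relation between
  the \<open>z\<^sub>i\<close> thus becomes, on a generic orbit, an algebraic relation over \<open>\<complex>(x)\<close> between the
  sequences \<open>\<partial>\<^sup>j z\<^sub>i (\<sigma>\<^sup>n x\<^sub>0)\<close>, whose differences are rational. The Kolchin--Ostrowski argument
  yields a linear relation with coefficients in \<open>\<complex>\<close>, valid at infinitely many points and
  hence identically. This specialisation replaces the descent from \<open>\<F>(x)\<close> to \<open>\<complex>(x)\<close>.
\<close>

section \<open>Algebraic relations between sequences with differences in a field\<close>

definition exponents :: "'i set \<Rightarrow> nat \<Rightarrow> ('i \<Rightarrow> nat) set" where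
  "exponents I d = {m \<in> I \<rightarrow>\<^sub>E UNIV. sum m I \<le> d}"

definition monom_seq :: "'i set \<Rightarrow> ('i \<Rightarrow> nat \<Rightarrow> complex) \<Rightarrow> ('i \<Rightarrow> nat) \<Rightarrow> nat \<Rightarrow> complex" where
  "monom_seq I w m n = (\<Prod>i\<in>I. w i n ^ m i)"

text \<open>The coefficient of the monomial \<open>m'\<close> in the expansion of the monomial
  \<open>m\<close> at \<open>w + b\<close>. Truncated subtraction in the exponent is harmless,
  because the binomial coefficient vanishes whenever \<open>m i < m' i\<close>.\<close>

definition shift_coeff ::
    "'i set \<Rightarrow> ('i \<Rightarrow> nat \<Rightarrow> complex) \<Rightarrow> ('i \<Rightarrow> nat) \<Rightarrow> ('i \<Rightarrow> nat) \<Rightarrow> nat \<Rightarrow> complex" where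
  "shift_coeff I b m m' n = (\<Prod>i\<in>I. of_nat (m i choose m' i) * b i n ^ (m i - m' i))"

text \<open>Zero in the ring of germs at infinity: sequences matter only up to finitely many
  terms.\<close>

definition null_seq :: "(nat \<Rightarrow> complex) \<Rightarrow> bool" where
  "null_seq s \<longleftrightarrow> (\<forall>\<^sub>F n in sequentially. s n = 0)"

lemma finite_exponents: 
  assumes "finite I" 
  shows "finite (exponents I d)"
proof (rule finite_subset)
  show "exponents I d \<subseteq> I \<rightarrow>\<^sub>E {..d}"
  proof
    fix m assume m: "m \<in> exponents I d"
    have "m i \<le> d" if "i \<in> I" for i
      using member_le_sum[of i I m] that assms m by (auto simp: exponents_def)
    with m show "m \<in> I \<rightarrow>\<^sub>E {..d}" by (auto simp: exponents_def PiE_def Pi_def)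
  qed
  show "finite (I \<rightarrow>\<^sub>E {..d})" using assms by (intro finite_PiE) auto
qed

lemma shift_coeff_eq_0:
  assumes "finite I" "i \<in> I" "m i < m' i"
  shows "shift_coeff I b m m' n = 0"
  unfolding shift_coeff_def using assms by (intro prod_zero) (auto simp: binomial_eq_0)

lemma shift_coeff_self: "shift_coeff I b m m n = 1"
  by (simp add: shift_coeff_def)

lemma shift_coeff_Suc:
  assumes "finite I" "i \<in> I"
  shows "shift_coeff I b (m(i := Suc (m i))) m n = of_nat (Suc (m i)) * b i n"
proof -
  have "(\<Prod>j\<in>I - {i}. of_nat ((m(i := Suc (m i))) j choose m j) * b j n ^ ((m(i := Suc (m i))) j - m j))
     = (1::complex)"
    by (rule prod.neutral) auto
  then show ?thesis
    unfolding shift_coeff_def by (subst prod.remove[OF assms]) (simp add: binomial_Suc_n)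
qed

text \<open>Write \<open>w i (Suc n)\<close> as \<open>w i n + b i n\<close>, apply the binomial
  theorem in each variable and multiply out.\<close>

lemma monom_seq_Suc:
  assumes "finite I" "m \<in> exponents I d"
  shows "monom_seq I w m (Suc n) =
    (\<Sum>m'\<in>exponents I d. shift_coeff I (\<lambda>i n. w i (Suc n) - w i n) m m' n * monom_seq I w m' n)"
proof -
  define b where "b = (\<lambda>i n. w i (Suc n) - w i n)"
  have "monom_seq I w m (Suc n) = (\<Prod>i\<in>I. (w i n + b i n) ^ m i)"
    by (simp add: monom_seq_def b_def)
  also have "\<dots> = (\<Prod>i\<in>I. \<Sum>k\<le>m i. of_nat (m i choose k) * w i n ^ k * b i n ^ (m i - k))"
    by (simp add: binomial_ring)
  also have "\<dots> = (\<Sum>m'\<in>PiE I (\<lambda>i. {..m i}).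
      \<Prod>i\<in>I. of_nat (m i choose m' i) * w i n ^ m' i * b i n ^ (m i - m' i))"
    using assms by (intro prod_sum_PiE) auto
  also have "\<dots> = (\<Sum>m'\<in>PiE I (\<lambda>i. {..m i}). shift_coeff I b m m' n * monom_seq I w m' n)"
    by (intro sum.cong refl) (simp add: shift_coeff_def monom_seq_def prod.distrib mult_ac)
  \<comment> \<open>Passing from the box below \<open>m\<close> to all of
    \<open>exponents I d\<close> only adds terms with some \<open>m i < m' i\<close>, whose
    coefficient is zero. The index set no longer depends on \<open>m\<close>, so sums can later be
    swapped.\<close>
  also have "\<dots> = (\<Sum>m'\<in>exponents I d. shift_coeff I b m m' n * monom_seq I w m' n)"
  proof (rule sum.mono_neutral_left)
    show "finite (exponents I d)" using assms by (simp add: finite_exponents)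
    show "PiE I (\<lambda>i. {..m i}) \<subseteq> exponents I d"
    proof
      fix m' assume m': "m' \<in> PiE I (\<lambda>i. {..m i})"
      then have "sum m' I \<le> sum m I" by (intro sum_mono) auto
      with m' assms(2) show "m' \<in> exponents I d" by (auto simp: exponents_def PiE_def)
    qed
    show "\<forall>m'\<in>exponents I d - PiE I (\<lambda>i. {..m i}). shift_coeff I b m m' n * monom_seq I w m' n = 0"
    proof
      fix m' assume "m' \<in> exponents I d - PiE I (\<lambda>i. {..m i})"
      then obtain i where "i \<in> I" "m i < m' i"
        by (auto simp: exponents_def PiE_def Pi_def not_le)
      then show "shift_coeff I b m m' n * monom_seq I w m' n = 0"
        using shift_coeff_eq_0[OF assms(1)] by simp
    qed
  qed
  finally show ?thesis by (simp add: b_def)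
qed

text \<open>The excesses \<open>g i - f i\<close> are natural numbers with total at most one, so at
  most one of them is nonzero.\<close>

lemma sum_le_Suc_cases:
  fixes f g :: "'i \<Rightarrow> nat"
  assumes "finite I" "\<And>i. i \<in> I \<Longrightarrow> f i \<le> g i" "sum g I \<le> Suc (sum f I)"
  shows "(\<forall>i\<in>I. g i = f i) \<or> (\<exists>i\<in>I. g i = Suc (f i) \<and> (\<forall>j\<in>I - {i}. g j = f j))"
proof (cases "\<forall>i\<in>I. g i = f i")
  case False
  then obtain i where i: "i \<in> I" "f i < g i" using assms(2) by (metis le_neq_implies_less)
  have le: "sum f (I - {i}) \<le> sum g (I - {i})" using assms(2) by (intro sum_mono) auto
  have dec: "sum f I = f i + sum f (I - {i})" "sum g I = g i + sum g (I - {i})"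
    using assms(1) i(1) by (auto simp: sum.remove)
  have eq: "sum f (I - {i}) = sum g (I - {i})" "g i = Suc (f i)"
    using le dec i(2) assms(3) by linarith+
  have "g j = f j" if "j \<in> I - {i}" for j
    using sum_mono_inv[OF eq(1) _ that] assms(1,2) by auto
  with i(1) eq(2) show ?thesis by blast
qed simp

lemma exponents_eqI:
  assumes "m \<in> exponents I d" "m' \<in> exponents I d'" "\<And>i. i \<in> I \<Longrightarrow> m i = m' i"
  shows "m = m'"
  using assms by (intro PiE_ext[of m I "\<lambda>_. UNIV" m']) (auto simp: exponents_def)

text \<open>Only an \<open>m'\<close> that dominates \<open>m\<close> pointwise contributes; since
  \<open>m\<close> already has the maximal degree \<open>d\<close>, that leaves \<open>m\<close>
  itself.\<close>

lemma sum_shift_coeff_top: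
  assumes "finite I" "m \<in> exponents I d" "sum m I = d"
  shows "(\<Sum>m'\<in>exponents I d. shift_coeff I b m' m n * x m') = x m"
proof -
  have "(\<Sum>m'\<in>exponents I d. shift_coeff I b m' m n * x m') = 
      (\<Sum>m'\<in>{m}. shift_coeff I b m' m n * x m')"
  proof (rule sum.mono_neutral_right)
    show "\<forall>m'\<in>exponents I d - {m}. shift_coeff I b m' m n * x m' = 0"
    proof
      fix m' assume m': "m' \<in> exponents I d - {m}"
      have "\<exists>i\<in>I. m' i < m i"
      proof (rule ccontr)
        assume "\<not> ?thesis"
        then have le: "m i \<le> m' i" if "i \<in> I" for i using that by (auto simp: not_less)
        moreover have "sum m I = sum m' I"
          using m' assms(3) sum_mono[of I m m'] le by (auto simp: exponents_def)
        ultimately have "m i = m' i" if "i \<in> I" for i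
          using sum_mono_inv[OF _ le that assms(1)] by simp
        then show False using m' exponents_eqI assms(2) by blast
      qed
      then show "shift_coeff I b m' m n * x m' = 0"
        using shift_coeff_eq_0[OF assms(1)] by auto
    qed
  qed (use assms(2) finite_exponents[OF assms(1)] in auto)
  then show ?thesis by (simp add: shift_coeff_self)
qed

text \<open>One degree below the top, the exponents dominating \<open>m\<close> are \<open>m\<close>
  itself and those with one coordinate raised by one. The latter bring in the differences
  \<open>b i\<close> linearly, which is the source of the final linear relation.\<close>

lemma sum_shift_coeff_subtop:
  assumes "finite I" "m \<in> exponents I d" "Suc (sum m I) = d"
  shows "(\<Sum>m'\<in>exponents I d. shift_coeff I b m' m n * x m') =
    x m + (\<Sum>i\<in>I. of_nat (Suc (m i)) * b i n * x (m(i := Suc (m i))))"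
proof -
  define h where "h = (\<lambda>i. m(i := Suc (m i)))"
  have hsum: "sum (h i) I = d" if "i \<in> I" for i
  proof -
    have "sum (h i) (I - {i}) = sum m (I - {i})" by (rule sum.cong) (auto simp: h_def)
    then have "sum (h i) I = Suc (sum m I)"
      using sum.remove[OF assms(1) that, of "h i"] sum.remove[OF assms(1) that, of m]
      by (simp add: h_def)
    then show ?thesis using assms by simp
  qed
  have hin: "h i \<in> exponents I d" if "i \<in> I" for i
    using hsum[OF that] assms(2) that by (auto simp: exponents_def h_def PiE_def extensional_def)
  have inj: "inj_on h I"
    by (rule inj_onI) (metis h_def fun_upd_same fun_upd_other n_not_Suc_n)
  have notin: "m \<notin> h ` I" using hsum assms(3) by (metis imageE n_not_Suc_n)
  have "(\<Sum>m'\<in>exponents I d. shift_coeff I b m' m n * x m') = 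
      (\<Sum>m'\<in>insert m (h ` I). shift_coeff I b m' m n * x m')"
  proof (rule sum.mono_neutral_right)
    show "\<forall>m'\<in>exponents I d - insert m (h ` I). shift_coeff I b m' m n * x m' = 0"
    proof
      fix m' assume m': "m' \<in> exponents I d - insert m (h ` I)"
      have "\<exists>i\<in>I. m' i < m i"
      proof (rule ccontr)
        assume "\<not> ?thesis"
        then have le: "m i \<le> m' i" if "i \<in> I" for i using that by (auto simp: not_less)
        have "sum m' I \<le> Suc (sum m I)" using m' assms(3) by (auto simp: exponents_def)
        from sum_le_Suc_cases[OF assms(1) le this] show False
        proof
          assume "\<forall>i\<in>I. m' i = m i"
          then show False using m' exponents_eqI assms(2) by blast
        next
          assume "\<exists>i\<in>I. m' i = Suc (m i) \<and> (\<forall>j\<in>I - {i}. m' j = m j)"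
          then obtain i where i: "i \<in> I" "m' i = Suc (m i)" "\<forall>j\<in>I - {i}. m' j = m j" by blast
          then have "m' = h i" using m' hin[OF i(1)]
            by (intro exponents_eqI[of m' I d "h i" d]) (auto simp: h_def)
          then show False using m' i(1) by auto
        qed
      qed
      then show "shift_coeff I b m' m n * x m' = 0"
        using shift_coeff_eq_0[OF assms(1)] by auto
    qed
  qed (use assms(1,2) finite_exponents[OF assms(1)] hin in auto)
  also have "\<dots> = x m + (\<Sum>i\<in>I. shift_coeff I b (h i) m n * x (h i))"
    using notin assms(1) by (simp add: sum.reindex[OF inj] shift_coeff_self o_def)
  also have "(\<Sum>i\<in>I. shift_coeff I b (h i) m n * x (h i)) = 
      (\<Sum>i\<in>I. of_nat (Suc (m i)) * b i n * x (h i))"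
    unfolding h_def using assms(1) by (intro sum.cong refl) (simp only: shift_coeff_Suc)
  finally show ?thesis by (simp add: h_def)
qed

text \<open>Modulo null sequences this is a difference field containing the constants: by
  \<open>dichotomy\<close> a nonzero germ is eventually nonvanishing, so its pointwise inverse is a
  true inverse.\<close>

locale sequence_field =
  fixes K :: "(nat \<Rightarrow> complex) set"
  assumes const: "(\<lambda>n. a) \<in> K"
    and diff: "s \<in> K \<Longrightarrow> t \<in> K \<Longrightarrow> (\<lambda>n. s n - t n) \<in> K"
    and mult: "s \<in> K \<Longrightarrow> t \<in> K \<Longrightarrow> (\<lambda>n. s n * t n) \<in> K"
    and inverse: "s \<in> K \<Longrightarrow> (\<lambda>n. inverse (s n)) \<in> K"
    and shift: "s \<in> K \<Longrightarrow> (\<lambda>n. s (Suc n)) \<in> K"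
    and dichotomy: "s \<in> K \<Longrightarrow> \<not> null_seq s \<Longrightarrow> \<forall>\<^sub>F n in sequentially. s n \<noteq> 0"
begin

lemma uminus: "s \<in> K \<Longrightarrow> (\<lambda>n. - s n) \<in> K"
  using diff[OF const[of 0]] by simp

lemma add: "s \<in> K \<Longrightarrow> t \<in> K \<Longrightarrow> (\<lambda>n. s n + t n) \<in> K"
  using diff[OF _ uminus] by fastforce

lemma sum: "(\<And>x. x \<in> S \<Longrightarrow> f x \<in> K) \<Longrightarrow> (\<lambda>n. \<Sum>x\<in>S. f x n) \<in> K"
  by (induction S rule: infinite_finite_induct) (auto intro: const add)

lemma prod: "(\<And>x. x \<in> S \<Longrightarrow> f x \<in> K) \<Longrightarrow> (\<lambda>n. \<Prod>x\<in>S. f x n) \<in> K"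
  by (induction S rule: infinite_finite_induct) (auto intro: const mult)

lemma power: "s \<in> K \<Longrightarrow> (\<lambda>n. s n ^ k) \<in> K"
  by (induction k) (auto intro: const mult)

section \<open>Polynomial relations over the sequence field and their minimal degree\<close>

definition relation :: "'i set \<Rightarrow> ('i \<Rightarrow> nat \<Rightarrow> complex) \<Rightarrow> nat \<Rightarrow> (('i \<Rightarrow> nat) \<Rightarrow> nat \<Rightarrow> complex) \<Rightarrow> bool"
  where "relation I w d c \<longleftrightarrow> (\<forall>m\<in>exponents I d. c m \<in> K) \<and>
    (\<exists>m\<in>exponents I d. \<not> null_seq (c m)) \<and>
    (\<forall>\<^sub>F n in sequentially. (\<Sum>m\<in>exponents I d. c m n * monom_seq I w m n) = 0)"

text \<open>In degree zero the only monomial is 1, so the relation would force its coefficient to be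
  null.\<close>

lemma relation_degree_pos:
  assumes "relation I w d c" "finite I"
  shows "d > 0"
proof (rule ccontr)
  assume "\<not> d > 0"
  then have "exponents I d = {\<lambda>i\<in>I. 0}"
    using assms(2) by (auto simp: exponents_def PiE_def extensional_def restrict_def)
  then show False using assms
    by (auto simp: relation_def monom_seq_def null_seq_def)
qed

lemma relation_lower_degree:
  assumes "relation I w d c" "finite I"
    and "\<And>m. m \<in> exponents I d \<Longrightarrow> sum m I = d \<Longrightarrow> null_seq (c m)"
  shows "relation I w (d - 1) c"
proof -
  have d: "d > 0" using relation_degree_pos assms by blast
  have sub: "exponents I (d - 1) \<subseteq> exponents I d" by (auto simp: exponents_def)
  have diff: "null_seq (c m)" if "m \<in> exponents I d - exponents I (d - 1)" for m
    using that d assms(3) by (fastforce simp: exponents_def)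
  have fin: "finite (exponents I d)" using assms finite_exponents by blast
  have "\<forall>\<^sub>F n in sequentially. \<forall>m\<in>exponents I d - exponents I (d - 1). c m n = 0"
    using diff fin by (intro eventually_ball_finite) (auto simp: null_seq_def)
  moreover have "\<forall>\<^sub>F n in sequentially. (\<Sum>m\<in>exponents I d. c m n * monom_seq I w m n) = 0"
    using assms by (simp add: relation_def)
  ultimately have "\<forall>\<^sub>F n in sequentially. (\<Sum>m\<in>exponents I (d - 1). c m n * monom_seq I w m n) = 0"
  proof eventually_elim
    case (elim n)
    have "(\<Sum>m\<in>exponents I (d - 1). c m n * monom_seq I w m n) = (\<Sum>m\<in>exponents I d. c m n * monom_seq I w m n)"
      by (rule sum.mono_neutral_left[OF fin sub]) (use elim in auto)
    then show ?case using elim by simp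
  qed
  then show ?thesis
    using assms(1) sub diff unfolding relation_def by blast
qed

text \<open>The Kolchin--Ostrowski argument: shifting a minimal relation that is normalised to have a
  leading coefficient 1 and subtracting it kills that coefficient, so the difference vanishes
  identically. The top coefficients are then constants and the coefficient of a monomial of
  degree one less yields the linear relation.\<close>
theorem kolchin_ostrowski:
  fixes w :: "'i \<Rightarrow> nat \<Rightarrow> complex"
  assumes fin: "finite I" and b: "\<And>i. i \<in> I \<Longrightarrow> (\<lambda>n. w i (Suc n) - w i n) \<in> K"
    and rel: "relation I w d0 c0"
  obtains \<kappa> g where "\<exists>i\<in>I. \<kappa> i \<noteq> 0" "g \<in> K"
    "\<forall>\<^sub>F n in sequentially. (\<Sum>i\<in>I. \<kappa> i * (w i (Suc n) - w i n)) = g (Suc n) - g n"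
proof -
  \<comment> \<open>Minimality is twofold: first the degree \<open>d\<close>, then, among relations
    of degree \<open>d\<close>, the number of non-null coefficients in top degree.\<close>
  define d where "d = (LEAST d. \<exists>c. relation I w d c)"
  have ex: "\<exists>c. relation I w d c" unfolding d_def by (rule LeastI) (use rel in blast)
  have dmin: "d \<le> d'" if "relation I w d' c" for d' c unfolding d_def by (rule Least_le) (use that in blast)
  define T where "T = (\<lambda>c. {m \<in> exponents I d. sum m I = d \<and> \<not> null_seq (c m)})"
  obtain c1 where c1: "relation I w d c1" and c1min: "\<And>c. relation I w d c \<Longrightarrow> card (T c1) \<le> card (T c)"
    using ex ex_has_least_nat[of "relation I w d" _ "\<lambda>c. card (T c)"] by blast
  have finE: "finite (exponents I d)" using finite_exponents fin by blast
  then have finT: "finite (T c)" for c by (simp add: T_def)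
  have d: "d > 0" using relation_degree_pos c1 fin by blast
  obtain m0 where m0: "m0 \<in> exponents I d" "sum m0 I = d" "\<not> null_seq (c1 m0)"
    using relation_lower_degree[OF c1 fin] dmin[of "d - 1" c1] d by fastforce
  define c where "c = (\<lambda>m n. c1 m n * inverse (c1 m0 n))"
  define b where "b = (\<lambda>i n. w i (Suc n) - w i n)"
  have bK: "b i \<in> K" if "i \<in> I" for i using assms(2)[OF that] by (simp add: b_def)
  have c1K: "c1 m \<in> K" if "m \<in> exponents I d" for m using c1 that by (auto simp: relation_def)
  have cK: "c m \<in> K" if "m \<in> exponents I d" for m
    using c1K that m0(1) by (auto simp: c_def intro!: mult inverse)
  have c_m0: "\<forall>\<^sub>F n in sequentially. c m0 n = 1"
    using dichotomy[OF c1K[OF m0(1)] m0(3)] by eventually_elim (simp add: c_def)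
  have c_null: "null_seq (c m)" if "null_seq (c1 m)" for m
    using that unfolding null_seq_def by eventually_elim (simp add: c_def)
  have c_rel: "\<forall>\<^sub>F n in sequentially. (\<Sum>m\<in>exponents I d. c m n * monom_seq I w m n) = 0"
  proof -
    have "\<forall>\<^sub>F n in sequentially. (\<Sum>m\<in>exponents I d. c1 m n * monom_seq I w m n) = 0"
      using c1 by (simp add: relation_def)
    then show ?thesis
    proof eventually_elim
      case (elim n)
      have "(\<Sum>m\<in>exponents I d. c m n * monom_seq I w m n) = 
          (\<Sum>m\<in>exponents I d. c1 m n * monom_seq I w m n) * inverse (c1 m0 n)"
        by (simp add: c_def sum_distrib_left mult_ac)
      with elim show ?case by simp
    qed
  qed
  \<comment> \<open>\<open>e m\<close> is the coefficient of the monomial \<open>m\<close> in the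
    shifted normalised relation, re-expanded at index \<open>n\<close>, minus the original
    relation.\<close>
  define e where "e = (\<lambda>m n. (\<Sum>m'\<in>exponents I d. shift_coeff I b m' m n * c m' (Suc n)) - c m n)"
  have eK: "e m \<in> K" if "m \<in> exponents I d" for m
    unfolding e_def shift_coeff_def
    by (intro diff sum mult prod power const cK shift bK that) 
  have e_top: "e m n = c m (Suc n) - c m n" if "m \<in> exponents I d" "sum m I = d" for m n
    using sum_shift_coeff_top[OF fin that] by (simp add: e_def)
  have e_rel: "\<forall>\<^sub>F n in sequentially. (\<Sum>m\<in>exponents I d. e m n * monom_seq I w m n) = 0"
    using c_rel eventually_sequentially_Suc[THEN iffD2, OF c_rel]
  proof eventually_elim
    case (elim n)
    have "0 = (\<Sum>m'\<in>exponents I d. c m' (Suc n) * monom_seq I w m' (Suc n))"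
      using elim by simp
    also have "\<dots> = (\<Sum>m'\<in>exponents I d. \<Sum>m\<in>exponents I d.
        c m' (Suc n) * (shift_coeff I b m' m n * monom_seq I w m n))"
      by (intro sum.cong refl) (simp add: monom_seq_Suc[OF fin] b_def sum_distrib_left)
    also have "\<dots> = (\<Sum>m\<in>exponents I d. \<Sum>m'\<in>exponents I d.
        c m' (Suc n) * (shift_coeff I b m' m n * monom_seq I w m n))"
      by (rule sum.swap)
    also have "\<dots> = (\<Sum>m\<in>exponents I d. (e m n + c m n) * monom_seq I w m n)"
      by (simp add: e_def sum_distrib_left sum_distrib_right mult_ac)
    also have "\<dots> = (\<Sum>m\<in>exponents I d. e m n * monom_seq I w m n)"
      using elim by (simp add: distrib_right sum.distrib)
    finally show ?case by simp
  qed
  \<comment> \<open>A non-null \<open>e m\<close> would make \<open>e\<close> a relation of degree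
    \<open>d\<close>. In top degree \<open>e\<close> is the difference of consecutive values of
    \<open>c\<close>, so its support lies in that of \<open>c1\<close> and misses \<open>m0\<close>,
    where \<open>c\<close> is eventually 1. This contradicts the choice of
    \<open>c1\<close>.\<close>
  have e_null: "null_seq (e m)" if "m \<in> exponents I d" for m
  proof (rule ccontr)
    assume "\<not> null_seq (e m)"
    then have "relation I w d e" using eK e_rel that by (auto simp: relation_def)
    then have "card (T c1) \<le> card (T e)" by (rule c1min)
    moreover have "T e \<subset> T c1"
    proof
      show "T e \<subseteq> T c1"
      proof
        fix m assume m: "m \<in> T e"
        have "\<not> null_seq (c1 m)"
        proof
          assume "null_seq (c1 m)"
          then have *: "\<forall>\<^sub>F n in sequentially. c m n = 0" using c_null by (simp add: null_seq_def)
          have "\<forall>\<^sub>F n in sequentially. e m n = 0"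
            using * eventually_sequentially_Suc[THEN iffD2, OF *]
            by eventually_elim (use m e_top in \<open>auto simp: T_def\<close>)
          then show False using m by (simp add: T_def null_seq_def)
        qed
        then show "m \<in> T c1" using m by (simp add: T_def)
      qed
      have "\<forall>\<^sub>F n in sequentially. e m0 n = 0"
        using c_m0 eventually_sequentially_Suc[THEN iffD2, OF c_m0]
        by eventually_elim (use m0 e_top in auto)
      then show "T e \<noteq> T c1" using m0 by (auto simp: T_def null_seq_def)
    qed
    ultimately show False using psubset_card_mono[OF finT] by (meson not_less)
  qed
  \<comment> \<open>In top degree the vanishing of \<open>e m\<close> says that consecutive values
    of \<open>c m\<close> agree from some index on.\<close>
  have c_const: "\<exists>\<kappa>. \<forall>\<^sub>F n in sequentially. c m n = \<kappa>" if m: "m \<in> exponents I d" "sum m I = d" for m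
  proof -
    obtain N where N: "e m n = 0" if "n \<ge> N" for n
      using e_null[OF m(1)] by (auto simp: null_seq_def eventually_sequentially)
    have "c m n = c m N" if "n \<ge> N" for n
      using that by (induction n rule: dec_induct) (use N e_top[OF m] in auto)
    then show ?thesis by (auto simp: eventually_sequentially)
  qed
  have "sum m0 I \<noteq> 0" using m0(2) d by simp
  then obtain i0 where i0: "i0 \<in> I" "m0 i0 > 0"
    using fin by auto
  \<comment> \<open>Lowering one exponent of \<open>m0\<close> makes \<open>m0\<close> one of the
    raised exponents of \<open>m1\<close>, which ensures that the constant
    \<open>\<kappa> i0\<close> is 1.\<close>
  define m1 where "m1 = m0(i0 := m0 i0 - 1)"
  have m0_eq: "m0 = m1(i0 := Suc (m1 i0))" using i0 by (auto simp: m1_def)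
  have m1_sum: "Suc (sum m1 I) = d"
  proof -
    have "sum m1 (I - {i0}) = sum m0 (I - {i0})" by (rule sum.cong) (auto simp: m1_def)
    then show ?thesis
      using sum.remove[OF fin i0(1), of m1] sum.remove[OF fin i0(1), of m0] m0(2) i0(2)
      by (simp add: m1_def)
  qed
  have m1: "m1 \<in> exponents I d" 
    using m0(1) m1_sum i0(1) by (auto simp: exponents_def m1_def PiE_def extensional_def)
  have up: "m1(i := Suc (m1 i)) \<in> exponents I d \<and> sum (m1(i := Suc (m1 i))) I = d" if "i \<in> I" for i
  proof -
    have "sum (m1(i := Suc (m1 i))) (I - {i}) = sum m1 (I - {i})" by (rule sum.cong) auto
    then have "sum (m1(i := Suc (m1 i))) I = d"
      using sum.remove[OF fin that, of "m1(i := Suc (m1 i))"] sum.remove[OF fin that, of m1] m1_sum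
      by simp
    then show ?thesis using m1 that by (auto simp: exponents_def PiE_def extensional_def)
  qed
  have "\<forall>i\<in>I. \<exists>\<kappa>. \<forall>\<^sub>F n in sequentially. c (m1(i := Suc (m1 i))) n = \<kappa>"
    using c_const up by blast
  then obtain \<kappa> where \<kappa>: "\<And>i. i \<in> I \<Longrightarrow> \<forall>\<^sub>F n in sequentially. c (m1(i := Suc (m1 i))) n = \<kappa> i"
    by metis
  have \<kappa>0: "\<kappa> i0 = 1"
  proof -
    have "\<forall>\<^sub>F n in sequentially. \<kappa> i0 = 1"
      using \<kappa>[OF i0(1)] c_m0 by eventually_elim (use m0_eq in auto)
    then show ?thesis by simp
  qed
  have all\<kappa>: "\<forall>\<^sub>F n in sequentially. \<forall>i\<in>I. c (m1(i := Suc (m1 i))) n = \<kappa> i"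
    using \<kappa> fin by (intro eventually_ball_finite) auto
  \<comment> \<open>The vanishing of \<open>e m1\<close> is read off through
    \<open>sum_shift_coeff_subtop\<close>. The factors \<open>Suc (m1 i)\<close> are absorbed into
    the constants and are nonzero in characteristic zero; the sequence whose difference appears is
    \<open>- c m1\<close>.\<close>
  show ?thesis
  proof
    show "\<exists>i\<in>I. of_nat (Suc (m1 i)) * \<kappa> i \<noteq> 0"
      using i0(1) \<kappa>0 by (intro bexI[of _ i0]) (auto simp del: of_nat_Suc)
    show "(\<lambda>n. - c m1 n) \<in> K" using cK m1 by (intro uminus)
    have "\<forall>\<^sub>F n in sequentially. e m1 n = 0" using e_null[OF m1] by (simp add: null_seq_def)
    with eventually_sequentially_Suc[THEN iffD2, OF all\<kappa>]
    show "\<forall>\<^sub>F n in sequentially. (\<Sum>i\<in>I. of_nat (Suc (m1 i)) * \<kappa> i * (w i (Suc n) - w i n)) =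
        - c m1 (Suc n) - - c m1 n"
    proof eventually_elim
      case (elim n)
      have "(\<Sum>i\<in>I. of_nat (Suc (m1 i)) * \<kappa> i * (w i (Suc n) - w i n)) = 
        (\<Sum>i\<in>I. of_nat (Suc (m1 i)) * b i n * c (m1(i := Suc (m1 i))) (Suc n))"
        using elim by (intro sum.cong refl) (simp add: b_def)
      moreover have "e m1 n = c m1 (Suc n) + 
        (\<Sum>i\<in>I. of_nat (Suc (m1 i)) * b i n * c (m1(i := Suc (m1 i))) (Suc n)) - c m1 n"
        using sum_shift_coeff_subtop[OF fin m1 m1_sum] by (simp add: e_def)
      ultimately show ?case using elim by (simp add: algebra_simps)
    qed
  qed
qed

end

section \<open>Restriction to orbits\<close>

text \<open>Unlike \<^const>\<open>rational_fun\<close>, this leaves the values at the poles unconstrained, which makes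
  it closed under the field operations and \<^const>\<open>deriv\<close>.\<close>
definition almost_rational :: "(complex \<Rightarrow> complex) \<Rightarrow> bool" where
  "almost_rational f \<longleftrightarrow>
    (\<exists>p r :: complex poly. r \<noteq> 0 \<and> (\<forall>x. poly r x \<noteq> 0 \<longrightarrow> f x = poly p x / poly r x))"

section \<open>Closure properties of functions that are rational off finitely many points\<close>

lemma rational_fun_imp_almost_rational: "rational_fun f \<Longrightarrow> almost_rational f"
  unfolding rational_fun_def almost_rational_def by auto

lemma almost_rational_const: "almost_rational (\<lambda>x. c)"
  unfolding almost_rational_def by (rule exI[of _ "[:c:]"], rule exI[of _ 1]) simp

lemma almost_rational_id: "almost_rational (\<lambda>x. x)"
  unfolding almost_rational_def by (rule exI[of _ "[:0, 1:]"], rule exI[of _ 1]) simp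

lemma almost_rational_diff:
  assumes "almost_rational f" "almost_rational g"
  shows "almost_rational (\<lambda>x. f x - g x)"
proof -
  obtain p r p' r' where "r \<noteq> 0" "\<And>x. poly r x \<noteq> 0 \<Longrightarrow> f x = poly p x / poly r x"
    "r' \<noteq> 0" "\<And>x. poly r' x \<noteq> 0 \<Longrightarrow> g x = poly p' x / poly r' x"
    using assms unfolding almost_rational_def by blast
  then show ?thesis unfolding almost_rational_def
    by (intro exI[of _ "p * r' - p' * r"] exI[of _ "r * r'"]) (auto simp: diff_frac_eq)
qed

lemma almost_rational_mult:
  assumes "almost_rational f" "almost_rational g"
  shows "almost_rational (\<lambda>x. f x * g x)"
proof -
  obtain p r p' r' where "r \<noteq> 0" "\<And>x. poly r x \<noteq> 0 \<Longrightarrow> f x = poly p x / poly r x"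
    "r' \<noteq> 0" "\<And>x. poly r' x \<noteq> 0 \<Longrightarrow> g x = poly p' x / poly r' x"
    using assms unfolding almost_rational_def by blast
  then show ?thesis unfolding almost_rational_def
    by (intro exI[of _ "p * p'"] exI[of _ "r * r'"]) auto
qed

text \<open>For a zero numerator, \<open>inverse 0 = 0\<close> gives the claim. Otherwise the
  denominator \<open>p * r\<close> excludes the zeros of \<open>p\<close> as well as the roots of
  \<open>r\<close>, where \<open>f\<close> is unconstrained.\<close>

lemma almost_rational_inverse:
  assumes "almost_rational f"
  shows "almost_rational (\<lambda>x. inverse (f x))"
proof -
  obtain p r where pr: "r \<noteq> 0" "\<And>x. poly r x \<noteq> 0 \<Longrightarrow> f x = poly p x / poly r x"
    using assms unfolding almost_rational_def by blast
  show ?thesis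
  proof (cases "p = 0")
    case True
    with pr show ?thesis unfolding almost_rational_def
      by (intro exI[of _ 0] exI[of _ r]) auto
  next
    case False
    with pr show ?thesis unfolding almost_rational_def
      by (intro exI[of _ "r * r"] exI[of _ "p * r"]) auto
  qed
qed

lemma almost_rational_uminus: "almost_rational f \<Longrightarrow> almost_rational (\<lambda>x. - f x)"
  using almost_rational_diff[OF almost_rational_const[of 0]] by simp

lemma almost_rational_add:
  "almost_rational f \<Longrightarrow> almost_rational g \<Longrightarrow> almost_rational (\<lambda>x. f x + g x)"
  using almost_rational_diff[OF _ almost_rational_uminus] by fastforce

lemma almost_rational_sum:
  "(\<And>i. i \<in> S \<Longrightarrow> almost_rational (f i)) \<Longrightarrow> almost_rational (\<lambda>x. \<Sum>i\<in>S. f i x)"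
  by (induction S rule: infinite_finite_induct) (auto intro: almost_rational_const almost_rational_add)

lemma almost_rational_affine:
  assumes "almost_rational f" "u \<noteq> 0"
  shows "almost_rational (\<lambda>x. f (u * x + v))"
proof -
  obtain p r where pr: "r \<noteq> 0" "\<And>x. poly r x \<noteq> 0 \<Longrightarrow> f x = poly p x / poly r x"
    using assms unfolding almost_rational_def by blast
  have "pcompose r [:v, u:] \<noteq> 0" using pr(1) assms(2) by (auto dest: pcompose_eq_0)
  then show ?thesis unfolding almost_rational_def
    using pr(2) by (intro exI[of _ "pcompose p [:v, u:]"] exI[of _ "pcompose r [:v, u:]"])
      (auto simp: poly_pcompose add.commute mult.commute)
qed

lemma almost_rational_deriv:
  assumes "almost_rational f"
  shows "almost_rational (deriv f)"
proof -
  obtain p r where pr: "r \<noteq> 0" "\<And>x. poly r x \<noteq> 0 \<Longrightarrow> f x = poly p x / poly r x"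
    using assms unfolding almost_rational_def by blast
  have "deriv f x = poly (pderiv p * r - p * pderiv r) x / poly (r * r) x" if "poly r x \<noteq> 0" for x
  proof -
    \<comment> \<open>The derivative needs agreement on a neighbourhood, which the openness of the
      nonvanishing set of \<open>r\<close> supplies.\<close>
    have "open {y. poly r y \<noteq> 0}" by (intro open_Collect_neq continuous_intros)
    then have "\<forall>\<^sub>F y in nhds x. f y = poly p y / poly r y"
      unfolding eventually_nhds using that pr(2) by auto
    then have "deriv f x = deriv (\<lambda>y. poly p y / poly r y) x"
      by (rule deriv_cong_ev) simp
    also have "\<dots> = (poly (pderiv p) x * poly r x - poly p x * poly (pderiv r) x) / (poly r x * poly r x)"
      by (rule DERIV_imp_deriv) (intro DERIV_divide poly_DERIV that)
    finally show ?thesis by simp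
  qed
  then show ?thesis unfolding almost_rational_def
    using pr(1) by (intro exI[of _ "pderiv p * r - p * pderiv r"] exI[of _ "r * r"]) auto
qed

lemma almost_rational_poly: "almost_rational (poly p)"
  unfolding almost_rational_def by (intro exI[of _ p] exI[of _ 1]) simp

lemma poly_nonzero_cosparse: 
  fixes r :: "complex poly"
  assumes "r \<noteq> 0" 
  shows "\<forall>\<^sub>\<approx>x\<in>A. poly r x \<noteq> 0"
  unfolding eventually_cosparse using poly_roots_finite[OF assms]
  by (intro finite_imp_sparse) simp

lemma almost_rational_imp_rational_fun:
  assumes "almost_rational f"
  obtains g where "rational_fun g" "\<forall>\<^sub>\<approx>x\<in>A. f x = g x"
proof -
  obtain p r where pr: "r \<noteq> 0" "\<And>x. poly r x \<noteq> 0 \<Longrightarrow> f x = poly p x / poly r x"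
    using assms unfolding almost_rational_def by blast
  have "\<forall>\<^sub>\<approx>x\<in>A. f x = poly p x / poly r x"
    using poly_nonzero_cosparse[OF pr(1)] by eventually_elim (use pr(2) in auto)
  then show ?thesis using that pr(1) unfolding rational_fun_def by blast
qed

text \<open>Infinitely many zeros force the numerator to be the zero polynomial. This identity
  principle carries information from a single orbit to the whole plane.\<close>

lemma finite_nonzeros_almost_rational:
  assumes "almost_rational f" "infinite {x. f x = 0}"
  shows "finite {x. f x \<noteq> 0}"
proof -
  obtain p r where pr: "r \<noteq> 0" "\<And>x. poly r x \<noteq> 0 \<Longrightarrow> f x = poly p x / poly r x"
    using assms unfolding almost_rational_def by blast
  have "{x. f x = 0} \<subseteq> {x. poly p x = 0} \<union> {x. poly r x = 0}" using pr(2) by auto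
  then have "infinite {x. poly p x = 0}"
    using assms(2) poly_roots_finite[OF pr(1)] by (meson finite_Un finite_subset)
  then have "p = 0" using poly_roots_finite by blast
  then have "{x. f x \<noteq> 0} \<subseteq> {x. poly r x = 0}" using pr(2) by auto
  then show ?thesis using poly_roots_finite[OF pr(1)] by (rule finite_subset)
qed

lemma ex_in_diff_countable: "uncountable A \<Longrightarrow> countable B \<Longrightarrow> \<exists>x. x \<in> A \<and> x \<notin> B"
  by (metis countable_subset subsetI)

text \<open>Common frame for both cases: the shift has \<open>u = v = 1\<close> and
  \<open>d = 1\<close>, the scaling has \<open>u = q\<close>, \<open>v = 0\<close> and
  \<open>d\<close> the polynomial \<open>x\<close>. The condition on \<open>d\<close> makes the
  derivation \<open>d(x) d/dx\<close> commute with the substitution; injectivity makes every orbit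
  infinite.\<close>

locale affine_difference =
  fixes A :: "complex set" and u v :: complex and d :: "complex poly"
  assumes open_A: "open A" and connected_A: "connected A" and uncountable_A: "uncountable A"
    and u: "u \<noteq> 0" and maps: "x \<in> A \<Longrightarrow> u * x + v \<in> A"
    and d: "poly d (u * x + v) = u * poly d x"
    and inj_orbit: "x \<in> A \<Longrightarrow> inj (\<lambda>n. ((\<lambda>x. u * x + v) ^^ n) x)"
begin

section \<open>Orbits, exceptional sets and the derivation\<close>

definition \<sigma> :: "complex \<Rightarrow> complex" where "\<sigma> x = u * x + v"

definition \<delta> :: "(complex \<Rightarrow> complex) \<Rightarrow> complex \<Rightarrow> complex" where
  "\<delta> f = (\<lambda>x. poly d x * deriv f x)"

definition orbit :: "complex \<Rightarrow> nat \<Rightarrow> complex" where "orbit x n = (\<sigma> ^^ n) x"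

definition invariants :: "(complex \<Rightarrow> complex) set" where
  "invariants = {f. f meromorphic_on A \<and> (\<forall>\<^sub>\<approx>x\<in>A. f (\<sigma> x) = f x)}"

definition orbit_field :: "complex \<Rightarrow> (nat \<Rightarrow> complex) set" where
  "orbit_field x = {s. \<exists>f. almost_rational f \<and> (\<forall>\<^sub>F n in sequentially. s n = f (orbit x n))}"

lemma \<sigma>_in: "x \<in> A \<Longrightarrow> \<sigma> x \<in> A"
  using maps by (simp add: \<sigma>_def)

lemma orbit_0 [simp]: "orbit x 0 = x"
  by (simp add: orbit_def)

lemma orbit_Suc: "orbit x (Suc n) = \<sigma> (orbit x n)"
  by (simp add: orbit_def)

lemma orbit_Suc': "orbit x (Suc n) = orbit (\<sigma> x) n"
  unfolding orbit_def by (simp add: funpow_swap1)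

lemma inj_orbit': "x \<in> A \<Longrightarrow> inj (orbit x)"
  using inj_orbit[of x] by (simp add: orbit_def[abs_def] \<sigma>_def[abs_def])

text \<open>An injective continuous map sends small punctured neighbourhoods of \<open>x\<close>
  into punctured neighbourhoods of \<open>\<sigma> x\<close>.\<close>

lemma cosparse_\<sigma>:
  assumes "\<forall>\<^sub>\<approx>x\<in>A. P x"
  shows "\<forall>\<^sub>\<approx>x\<in>A. P (\<sigma> x)"
proof -
  have "\<forall>\<^sub>F y in at x. P (\<sigma> y)" if "x \<in> A" for x
  proof -
    have "filterlim \<sigma> (at (\<sigma> x)) (at x)"
    proof (rule filterlim_atI)
      show "(\<sigma> \<longlongrightarrow> \<sigma> x) (at x)" unfolding \<sigma>_def[abs_def] by (intro tendsto_intros)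
      show "\<forall>\<^sub>F y in at x. \<sigma> y \<noteq> \<sigma> x"
        using u by (auto simp: \<sigma>_def eventually_at_filter)
    qed
    moreover have "eventually P (at (\<sigma> x))"
      using assms \<sigma>_in[OF that] open_A by (simp add: eventually_cosparse_open_eq)
    ultimately show ?thesis by (rule eventually_compose_filterlim[rotated])
  qed
  then show ?thesis using open_A by (simp add: eventually_cosparse_open_eq)
qed

lemma cosparse_in: "\<forall>\<^sub>\<approx>x\<in>A. x \<in> A"
  using open_A by (simp add: eventually_in_cosparse)

text \<open>Makes it possible to differentiate identities that hold only almost everywhere.\<close>

lemma cosparse_nhds:
  assumes "\<forall>\<^sub>\<approx>x\<in>A. P x"
  shows "\<forall>\<^sub>\<approx>x\<in>A. \<forall>\<^sub>F y in nhds x. P y"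
  using assms cosparse_in
proof eventually_elim
  case (elim x)
  then have "eventually P (at x)" using assms open_A by (simp add: eventually_cosparse_open_eq)
  then show ?case using elim(1) by (simp add: eventually_nhds_conv_at)
qed

lemma countable_cosparse:
  assumes "\<forall>\<^sub>\<approx>x\<in>A. P x"
  shows "countable {x \<in> A. \<not> P x}"
  using sparse_imp_countable[OF open_A] assms unfolding eventually_cosparse
  by (metis Collect_conj_eq Collect_mem_eq)

text \<open>Each iterate contributes a countable exceptional set, and there are countably many
  iterates. An uncountable domain then offers base points whose entire orbit is good.\<close>

lemma countable_cosparse_orbit:
  assumes "\<forall>\<^sub>\<approx>x\<in>A. P x"
  shows "countable {x \<in> A. \<not> (\<forall>n. P (orbit x n))}"
proof -
  have "\<forall>\<^sub>\<approx>x\<in>A. P (orbit x n)" for n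
  proof (induction n)
    case (Suc n)
    then show ?case using cosparse_\<sigma>[of "\<lambda>x. P (orbit x n)"] by (simp add: orbit_Suc')
  qed (use assms in simp)
  then have "countable (\<Union>n. {x \<in> A. \<not> P (orbit x n)})"
    using countable_cosparse by (intro countable_UN) auto
  moreover have "{x \<in> A. \<not> (\<forall>n. P (orbit x n))} = (\<Union>n. {x \<in> A. \<not> P (orbit x n)})" by auto
  ultimately show ?thesis by simp
qed

lemma meromorphic_\<delta>:
  assumes "f meromorphic_on A"
  shows "\<delta> f meromorphic_on A"
proof -
  have "poly d holomorphic_on UNIV" by (rule poly_holomorphic_on[OF holomorphic_on_ident])
  then have "poly d analytic_on A"
    using analytic_on_open analytic_on_subset open_UNIV subset_UNIV by metis
  then show ?thesis
    unfolding \<delta>_def using assms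
    by (rule meromorphic_on_mult[OF analytic_on_imp_meromorphic_on meromorphic_on_deriv])
qed

lemma meromorphic_\<delta>_funpow: "f meromorphic_on A \<Longrightarrow> (\<delta> ^^ j) f meromorphic_on A"
  by (induction j) (auto intro: meromorphic_\<delta>)

lemma almost_rational_\<delta>_funpow: "almost_rational f \<Longrightarrow> almost_rational ((\<delta> ^^ j) f)"
  by (induction j)
    (auto simp: \<delta>_def intro!: almost_rational_mult almost_rational_deriv almost_rational_poly)

text \<open>The chain rule applied to \<open>z (\<sigma> x)\<close> yields a factor
  \<open>u\<close>, which the transformation law of \<open>d\<close> turns into the value of
  \<open>d\<close> at \<open>\<sigma> x\<close>.\<close>

lemma \<delta>_difference:
  assumes z: "z meromorphic_on A" and a: "\<forall>\<^sub>\<approx>x\<in>A. z (\<sigma> x) - z x = a x"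
  shows "\<forall>\<^sub>\<approx>x\<in>A. \<delta> z (\<sigma> x) - \<delta> z x = \<delta> a x"
proof -
  have an: "\<forall>\<^sub>\<approx>x\<in>A. z analytic_on {x}" using z by (rule meromorphic_on_imp_analytic_cosparse)
  show ?thesis
    using cosparse_nhds[OF a] an cosparse_\<sigma>[OF an]
  proof eventually_elim
    case (elim x)
    have 1: "(z has_field_derivative deriv z x) (at x)"
      using elim(2) analytic_on_imp_differentiable_at DERIV_deriv_iff_field_differentiable by blast
    have 2: "(z has_field_derivative deriv z (\<sigma> x)) (at (\<sigma> x))"
      using elim(3) analytic_on_imp_differentiable_at DERIV_deriv_iff_field_differentiable by blast
    have "(\<sigma> has_field_derivative u) (at x)" unfolding \<sigma>_def[abs_def]
      by (auto intro!: derivative_eq_intros)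
    from DERIV_diff[OF DERIV_chain2[OF 2 this] 1]
    have "deriv (\<lambda>y. z (\<sigma> y) - z y) x = deriv z (\<sigma> x) * u - deriv z x"
      by (rule DERIV_imp_deriv)
    moreover have "deriv (\<lambda>y. z (\<sigma> y) - z y) x = deriv a x"
      using elim(1) by (rule deriv_cong_ev) simp
    ultimately have "deriv a x = deriv z (\<sigma> x) * u - deriv z x" by simp
    then show ?case using d[of x] by (simp add: \<delta>_def \<sigma>_def right_diff_distrib mult_ac)
  qed
qed

lemma \<delta>_funpow_difference:
  assumes "z meromorphic_on A" "\<forall>\<^sub>\<approx>x\<in>A. z (\<sigma> x) - z x = a x"
  shows "\<forall>\<^sub>\<approx>x\<in>A. (\<delta> ^^ j) z (\<sigma> x) - (\<delta> ^^ j) z x = (\<delta> ^^ j) a x"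
  using assms by (induction j) (auto intro: \<delta>_difference meromorphic_\<delta>_funpow)

lemma orbit_avoids_finite:
  assumes "x \<in> A" "finite S"
  shows "\<forall>\<^sub>F n in sequentially. orbit x n \<notin> S"
  using finite_vimageI[OF assms(2) inj_orbit'[OF assms(1)]]
  by (simp add: cofinite_eq_sequentially[symmetric] eventually_cofinite vimage_def)

lemma orbit_fieldI:
  "almost_rational f \<Longrightarrow> \<forall>\<^sub>F n in sequentially. s n = f (orbit x n) \<Longrightarrow> s \<in> orbit_field x"
  unfolding orbit_field_def by blast

lemma sequence_field_orbit_field:
  assumes x: "x \<in> A"
  shows "sequence_field (orbit_field x)"
proof
  fix a show "(\<lambda>n. a) \<in> orbit_field x"
    by (rule orbit_fieldI[OF almost_rational_const]) simp
next
  fix s t assume "s \<in> orbit_field x" "t \<in> orbit_field x"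
  then obtain f g where fg: "almost_rational f" "almost_rational g"
    and s: "\<forall>\<^sub>F n in sequentially. s n = f (orbit x n)"
    and t: "\<forall>\<^sub>F n in sequentially. t n = g (orbit x n)"
    unfolding orbit_field_def by blast
  show "(\<lambda>n. s n - t n) \<in> orbit_field x"
    by (rule orbit_fieldI[OF almost_rational_diff[OF fg]]) (use s t in eventually_elim, simp)
  show "(\<lambda>n. s n * t n) \<in> orbit_field x"
    by (rule orbit_fieldI[OF almost_rational_mult[OF fg]]) (use s t in eventually_elim, simp)
next
  fix s assume "s \<in> orbit_field x"
  then obtain f where f: "almost_rational f"
    and s: "\<forall>\<^sub>F n in sequentially. s n = f (orbit x n)"
    unfolding orbit_field_def by blast
  show "(\<lambda>n. inverse (s n)) \<in> orbit_field x"
    by (rule orbit_fieldI[OF almost_rational_inverse[OF f]]) (use s in eventually_elim, simp)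
  show "(\<lambda>n. s (Suc n)) \<in> orbit_field x"
    by (rule orbit_fieldI[OF almost_rational_affine[OF f u, of v]])
      (use eventually_sequentially_Suc[THEN iffD2, OF s] in eventually_elim, simp add: orbit_Suc \<sigma>_def)
  \<comment> \<open>With infinitely many zeros, \<open>f\<close> would vanish off a finite set,
    which the orbit eventually leaves, so \<open>s\<close> would be null. Hence the zero set is
    finite, and the orbit eventually avoids it.\<close>
  assume nz: "\<not> null_seq s"
  have fin: "finite {x. f x = 0}"
  proof (rule ccontr)
    assume "infinite {x. f x = 0}"
    from orbit_avoids_finite[OF x finite_nonzeros_almost_rational[OF f this]] s
    have "\<forall>\<^sub>F n in sequentially. s n = 0" by eventually_elim simp
    with nz show False by (simp add: null_seq_def)
  qed
  show "\<forall>\<^sub>F n in sequentially. s n \<noteq> 0"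
    using s orbit_avoids_finite[OF x fin] by eventually_elim auto
qed

lemma adjoin_x_meromorphic:
  assumes "f \<in> adjoin_x A invariants"
  shows "f meromorphic_on A"
  using assms unfolding adjoin_x_def
proof (induction rule: generated_field.induct)
  case (cong f g)
  then show ?case using meromorphic_on_cong'[of g f A A] by simp
qed (auto simp: invariants_def intro!: meromorphic_intros)

text \<open>Induction over the generation of the field: \<open>x\<close> restricts to the identity
  function, an invariant to a constant on all but countably many orbits, and each field operation or
  change of representative merges countable exceptional sets.\<close>

lemma adjoin_x_orbit:
  assumes "f \<in> adjoin_x A invariants"
  shows "countable {x \<in> A. (\<lambda>n. f (orbit x n)) \<notin> orbit_field x}"
  using assms unfolding adjoin_x_def
proof (induction rule: generated_field.induct)
  case (generator f)
  then show ?case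
  proof
    assume "f = (\<lambda>x. x)"
    then have "(\<lambda>n. f (orbit x n)) \<in> orbit_field x" for x
      by (intro orbit_fieldI[OF almost_rational_id]) simp
    then show ?thesis by simp
  next
    assume "f \<in> invariants"
    then have "countable {x \<in> A. \<not> (\<forall>n. f (\<sigma> (orbit x n)) = f (orbit x n))}"
      by (intro countable_cosparse_orbit) (simp add: invariants_def)
    moreover have "(\<lambda>n. f (orbit x n)) \<in> orbit_field x"
      if "\<forall>n. f (\<sigma> (orbit x n)) = f (orbit x n)" for x
    proof -
      have "f (orbit x n) = f x" for n by (induction n) (use that in \<open>auto simp: orbit_Suc\<close>)
      then show ?thesis by (intro orbit_fieldI[OF almost_rational_const[of "f x"]]) simp
    qed
    ultimately show ?thesis by (elim countable_subset[rotated]) blast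
  qed
next
  case one
  have "(\<lambda>n. 1) \<in> orbit_field x" for x
    by (intro orbit_fieldI[OF almost_rational_const[of 1]]) simp
  then show ?case by simp
next
  case (diff f g)
  from countable_Un[OF diff.IH] show ?case
    by (rule countable_subset[rotated]) (use sequence_field.diff[OF sequence_field_orbit_field] in blast)
next
  case (mult f g)
  from countable_Un[OF mult.IH] show ?case
    by (rule countable_subset[rotated]) (use sequence_field.mult[OF sequence_field_orbit_field] in blast)
next
  case (inverse f)
  from inverse.IH show ?case
    by (rule countable_subset[rotated]) (use sequence_field.inverse[OF sequence_field_orbit_field] in blast)
next
  case (cong f g)
  have "(\<lambda>n. g (orbit x n)) = (\<lambda>n. f (orbit x n))" if "\<forall>n. g (orbit x n) = f (orbit x n)" for x
    using that by auto
  then show ?case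
    by (intro countable_subset[OF _ countable_Un[OF cong.IH countable_cosparse_orbit[OF cong.hyps(2)]]])
      force
qed

section \<open>From differential dependence to a linear relation\<close>

theorem dependent_imp_linear_relation:
  assumes az: "\<forall>i\<in>{1..n}. rational_fun (a i) \<and> z i meromorphic_on A \<and>
      (\<forall>\<^sub>\<approx>x\<in>A. z i (\<sigma> x) - z i x = a i x)"
    and dep: "diff_dependent A \<delta> (adjoin_x A invariants) n z"
  shows "\<exists>L\<in>linear_diff_polys n. L \<noteq> 0 \<and> (\<exists>g. rational_fun g \<and>
      (\<forall>\<^sub>\<approx>x\<in>A. eval_linear_diff_poly \<delta> L a x = g (\<sigma> x) - g x))"
proof -
  obtain P where P: "P \<in> diff_polys (adjoin_x A invariants) n" "diff_poly_nonzero A P"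
    "\<forall>\<^sub>\<approx>x\<in>A. eval_diff_poly \<delta> P z x = 0"
    using dep unfolding diff_dependent_def by blast
  define M where "M = Poly_Mapping.keys P"
  define C where "C = Poly_Mapping.lookup P"
  \<comment> \<open>The derivatives occurring in \<open>P\<close> are treated as separate unknowns
    indexed by pairs; the derivation enters only through the rationality of their differences
    \<open>B\<close>.\<close>
  define I where "I = (\<Union>m\<in>M. Poly_Mapping.keys m)"
  define W where "W = (\<lambda>(i, j). (\<delta> ^^ j) (z i))"
  define B where "B = (\<lambda>(i, j). (\<delta> ^^ j) (a i))"
  have finM: "finite M" by (simp add: M_def)
  have finI: "finite I" by (simp add: I_def finM)
  have I_sub: "I \<subseteq> {1..n} \<times> UNIV" using P(1) by (fastforce simp: diff_polys_def I_def M_def)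
  have C_in: "C m \<in> adjoin_x A invariants" if "m \<in> M" for m
    using P(1) that by (auto simp: diff_polys_def M_def C_def)
  have W_diff: "\<forall>\<^sub>\<approx>x\<in>A. W k (\<sigma> x) - W k x = B k x" if "k \<in> I" for k
  proof -
    obtain i j where k: "k = (i, j)" by (cases k)
    then have "i \<in> {1..n}" using that I_sub by auto
    then show ?thesis unfolding W_def B_def k using az \<delta>_funpow_difference by auto
  qed
  have B_rat: "almost_rational (B k)" if "k \<in> I" for k
  proof -
    obtain i j where k: "k = (i, j)" by (cases k)
    then have "i \<in> {1..n}" using that I_sub by auto
    then show ?thesis unfolding B_def k
      using az almost_rational_\<delta>_funpow rational_fun_imp_almost_rational by auto
  qed
  obtain m0 where m0: "\<not> (\<forall>\<^sub>\<approx>x\<in>A. C m0 x = 0)"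
    using P(2) unfolding diff_poly_nonzero_def C_def by blast
  have m0_in: "m0 \<in> M"
  proof (rule ccontr)
    assume "m0 \<notin> M"
    then have "C m0 = 0" by (simp add: M_def C_def in_keys_iff)
    with m0 show False by simp
  qed
  \<comment> \<open>A meromorphic function on a connected open set is either almost everywhere zero
    or almost everywhere nonzero.\<close>
  have m0_nz: "\<forall>\<^sub>\<approx>x\<in>A. C m0 x \<noteq> 0"
    using meromorphic_imp_constant_or_avoid[OF adjoin_x_meromorphic[OF C_in[OF m0_in]] open_A connected_A, of 0]
      m0 by blast
  \<comment> \<open>Each requirement on the base point fails on a countable set only, so the
    uncountable \<open>A\<close> contains a point \<open>x0\<close> meeting all of them.\<close>
  have "countable (\<Union>m\<in>M. {x \<in> A. (\<lambda>n. C m (orbit x n)) \<notin> orbit_field x})"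
    using finM C_in adjoin_x_orbit by (intro countable_UN[OF countable_finite]) auto
  moreover have "\<forall>\<^sub>\<approx>x\<in>A. \<forall>k\<in>I. W k (\<sigma> x) - W k x = B k x"
    using W_diff finI by (intro eventually_ball_finite) auto
  note countable_cosparse_orbit[OF this]
  ultimately have "countable ({x \<in> A. \<not> (\<forall>n. C m0 (orbit x n) \<noteq> 0)} \<union>
      {x \<in> A. \<not> (\<forall>n. eval_diff_poly \<delta> P z (orbit x n) = 0)} \<union>
      {x \<in> A. \<not> (\<forall>n. \<forall>k\<in>I. W k (\<sigma> (orbit x n)) - W k (orbit x n) = B k (orbit x n))} \<union>
      (\<Union>m\<in>M. {x \<in> A. (\<lambda>n. C m (orbit x n)) \<notin> orbit_field x}))" (is "countable ?bad")
    using countable_cosparse_orbit[OF m0_nz] countable_cosparse_orbit[OF P(3)]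
    by (intro countable_Un)
  from ex_in_diff_countable[OF uncountable_A this] obtain x0 where "x0 \<in> A" "x0 \<notin> ?bad"
    by (elim exE conjE)
  then have x0: "x0 \<in> A" "\<And>n. C m0 (orbit x0 n) \<noteq> 0" "\<And>n. eval_diff_poly \<delta> P z (orbit x0 n) = 0"
    "\<And>n k. k \<in> I \<Longrightarrow> W k (orbit x0 (Suc n)) - W k (orbit x0 n) = B k (orbit x0 n)"
    "\<And>m. m \<in> M \<Longrightarrow> (\<lambda>n. C m (orbit x0 n)) \<in> orbit_field x0"
    by (auto simp: orbit_Suc)
  interpret sequence_field "orbit_field x0" by (rule sequence_field_orbit_field[OF x0(1)])
  define w where "w = (\<lambda>k n. W k (orbit x0 n))"
  \<comment> \<open>Translates finitely supported monomials into extensional exponents on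
    \<open>I\<close>. No information is lost, as all keys of monomials in \<open>M\<close> lie in
    \<open>I\<close>.\<close>
  define R where "R = (\<lambda>m :: monomial. restrict (Poly_Mapping.lookup m) I)"
  have inj: "inj_on R M"
  proof (rule inj_onI)
    fix m m' assume m: "m \<in> M" "m' \<in> M" and eq: "R m = R m'"
    show "m = m'"
    proof (rule poly_mapping_eqI)
      fix k
      show "Poly_Mapping.lookup m k = Poly_Mapping.lookup m' k"
      proof (cases "k \<in> I")
        case True
        then show ?thesis using fun_cong[OF eq, of k] by (simp add: R_def)
      next
        case False
        then have "k \<notin> Poly_Mapping.keys m" "k \<notin> Poly_Mapping.keys m'" using m by (auto simp: I_def)
        then show ?thesis by (simp add: in_keys_iff)
      qed
    qed
  qed
  \<comment> \<open>A crude bound: the sum of all degrees dominates each of them.\<close>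
  define deg where "deg = (\<Sum>m\<in>M. sum (R m) I)"
  have R_in: "R m \<in> exponents I deg" if "m \<in> M" for m
    using member_le_sum[OF that, of "\<lambda>m. sum (R m) I"] finM by (auto simp: exponents_def deg_def R_def)
  define c where "c = (\<lambda>\<mu> n. if \<mu> \<in> R ` M then C (the_inv_into M R \<mu>) (orbit x0 n) else 0)"
  have c_R: "c (R m) n = C m (orbit x0 n)" if "m \<in> M" for m n
    using that inj by (simp add: c_def the_inv_into_f_f)
  have mon: "(\<Prod>(i, j)\<in>Poly_Mapping.keys m. ((\<delta> ^^ j) (z i) (orbit x0 n)) ^ Poly_Mapping.lookup m (i, j)) =
      monom_seq I w (R m) n" if "m \<in> M" for m n
  proof -
    have "(\<Prod>(i, j)\<in>Poly_Mapping.keys m. ((\<delta> ^^ j) (z i) (orbit x0 n)) ^ Poly_Mapping.lookup m (i, j)) =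
        (\<Prod>k\<in>Poly_Mapping.keys m. w k n ^ Poly_Mapping.lookup m k)"
      by (intro prod.cong) (auto simp: w_def W_def)
    also have "\<dots> = (\<Prod>k\<in>I. w k n ^ Poly_Mapping.lookup m k)"
      using that finI by (intro prod.mono_neutral_left) (auto simp: I_def in_keys_iff)
    also have "\<dots> = monom_seq I w (R m) n"
      unfolding monom_seq_def by (intro prod.cong) (auto simp: R_def)
    finally show ?thesis .
  qed
  have rel: "relation I w deg c"
    unfolding relation_def
  proof (intro conjI ballI bexI)
    fix \<mu> assume "\<mu> \<in> exponents I deg"
    show "c \<mu> \<in> orbit_field x0"
    proof (cases "\<mu> \<in> R ` M")
      case True
      then obtain m where "m \<in> M" "\<mu> = R m" by blast
      then show ?thesis using x0(5) c_R by (metis (no_types, lifting) ext)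
    next
      case False
      then have "c \<mu> = (\<lambda>n. 0)" by (auto simp: c_def)
      then show ?thesis using const by simp
    qed
  next
    show "R m0 \<in> exponents I deg" by (rule R_in[OF m0_in])
    show "\<not> null_seq (c (R m0))"
      using x0(2) c_R[OF m0_in] by (auto simp: null_seq_def)
    have "(\<Sum>\<mu>\<in>exponents I deg. c \<mu> n * monom_seq I w \<mu> n) = 0" for n
    proof -
      have "(\<Sum>\<mu>\<in>exponents I deg. c \<mu> n * monom_seq I w \<mu> n) = (\<Sum>\<mu>\<in>R ` M. c \<mu> n * monom_seq I w \<mu> n)"
        using R_in finite_exponents[OF finI] by (intro sum.mono_neutral_right) (auto simp: c_def)
      also have "\<dots> = (\<Sum>m\<in>M. C m (orbit x0 n) * monom_seq I w (R m) n)"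
        using c_R by (simp add: sum.reindex[OF inj])
      also have "\<dots> = eval_diff_poly \<delta> P z (orbit x0 n)"
        unfolding eval_diff_poly_def using mon by (intro sum.cong) (auto simp: M_def C_def)
      finally show ?thesis using x0(3) by simp
    qed
    then show "\<forall>\<^sub>F n in sequentially. (\<Sum>\<mu>\<in>exponents I deg. c \<mu> n * monom_seq I w \<mu> n) = 0" by simp
  qed
  have w_B: "(\<lambda>n. w k (Suc n) - w k n) = (\<lambda>n. B k (orbit x0 n))" if "k \<in> I" for k
    using x0(4)[OF that] by (simp add: w_def)
  then have w_diff: "(\<lambda>n. w k (Suc n) - w k n) \<in> orbit_field x0" if "k \<in> I" for k
    using that by (auto intro: orbit_fieldI[OF B_rat[OF that]])
  obtain \<kappa> s where \<kappa>: "\<exists>k\<in>I. \<kappa> k \<noteq> 0" and s: "s \<in> orbit_field x0"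
    "\<forall>\<^sub>F n in sequentially. (\<Sum>k\<in>I. \<kappa> k * (w k (Suc n) - w k n)) = s (Suc n) - s n"
    using kolchin_ostrowski[OF finI w_diff rel] by blast
  obtain G where G: "almost_rational G" "\<forall>\<^sub>F n in sequentially. s n = G (orbit x0 n)"
    using s(1) unfolding orbit_field_def by blast
  \<comment> \<open>The defect of the desired identity. It is rational and vanishes on a tail of the
    chosen orbit, so it vanishes almost everywhere; the dependence on \<open>x0\<close> disappears
    here.\<close>
  define F where "F = (\<lambda>x. (\<Sum>k\<in>I. \<kappa> k * B k x) - (G (\<sigma> x) - G x))"
  have F_rat: "almost_rational F"
    unfolding F_def \<sigma>_def using B_rat G(1) u
    by (intro almost_rational_diff almost_rational_sum almost_rational_mult almost_rational_const
        almost_rational_affine)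
  have "\<forall>\<^sub>F n in sequentially. F (orbit x0 n) = 0"
    using s(2) G(2) eventually_sequentially_Suc[THEN iffD2, OF G(2)]
  proof eventually_elim
    case (elim n)
    have "(\<Sum>k\<in>I. \<kappa> k * B k (orbit x0 n)) = (\<Sum>k\<in>I. \<kappa> k * (w k (Suc n) - w k n))"
      using x0(4) by (intro sum.cong) (auto simp: w_def)
    with elim show ?case by (simp add: F_def orbit_Suc)
  qed
  \<comment> \<open>Were the zero set finite, the orbit would eventually avoid it.\<close>
  then have "infinite {x. F x = 0}"
    using orbit_avoids_finite[OF x0(1), of "{x. F x = 0}"]
    by (metis (mono_tags, lifting) eventually_conj eventually_happens' mem_Collect_eq sequentially_bot)
  then have F0: "\<forall>\<^sub>\<approx>x\<in>A. F x = 0"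
    using finite_nonzeros_almost_rational[OF F_rat] unfolding eventually_cosparse
    by (intro finite_imp_sparse) simp
  obtain g where g: "rational_fun g" "\<forall>\<^sub>\<approx>x\<in>A. G x = g x"
    using almost_rational_imp_rational_fun[OF G(1)] by blast
  define L where "L = Abs_poly_mapping (\<lambda>k. if k \<in> I then \<kappa> k else 0)"
  have L: "Poly_Mapping.lookup L = (\<lambda>k. if k \<in> I then \<kappa> k else 0)"
    unfolding L_def by (rule lookup_Abs_poly_mapping) (use finI in simp)
  have keys_L: "Poly_Mapping.keys L \<subseteq> I" by (auto simp: in_keys_iff L split: if_splits)
  have eval_L: "eval_linear_diff_poly \<delta> L a x = (\<Sum>k\<in>I. \<kappa> k * B k x)" for x
  proof -
    have "eval_linear_diff_poly \<delta> L a x = (\<Sum>k\<in>Poly_Mapping.keys L. Poly_Mapping.lookup L k * B k x)"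
      unfolding eval_linear_diff_poly_def by (intro sum.cong) (auto simp: B_def)
    also have "\<dots> = (\<Sum>k\<in>I. Poly_Mapping.lookup L k * B k x)"
      using finI keys_L by (intro sum.mono_neutral_left) (auto simp: in_keys_iff)
    finally show ?thesis by (simp add: L)
  qed
  show ?thesis
  proof (intro bexI conjI exI)
    show "L \<in> linear_diff_polys n" using keys_L I_sub by (auto simp: linear_diff_polys_def)
    show "L \<noteq> 0" using \<kappa> L by (metis lookup_zero)
    show "rational_fun g" by (rule g(1))
    show "\<forall>\<^sub>\<approx>x\<in>A. eval_linear_diff_poly \<delta> L a x = g (\<sigma> x) - g x"
      using F0 g(2) cosparse_\<sigma>[OF g(2)] by eventually_elim (simp add: eval_L F_def)
  qed
qed

section \<open>From a linear relation to differential dependence\<close>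

lemma const_in_adjoin_x: "(\<lambda>x. c) \<in> adjoin_x A invariants"
  unfolding adjoin_x_def by (rule generated_field.generator) (simp add: invariants_def meromorphic_on_const)

lemma add_in_adjoin_x:
  assumes "f \<in> adjoin_x A invariants" "g \<in> adjoin_x A invariants"
  shows "(\<lambda>x. f x + g x) \<in> adjoin_x A invariants"
proof -
  have "(\<lambda>x. f x - (0 - g x)) \<in> adjoin_x A invariants"
    using assms const_in_adjoin_x[of 0] unfolding adjoin_x_def by (intro generated_field.diff)
  then show ?thesis by simp
qed

lemma poly_in_adjoin_x: "poly p \<in> adjoin_x A invariants"
proof (induction p)
  case 0
  then show ?case using const_in_adjoin_x[of 0] by (simp add: poly_0[abs_def])
next
  case (pCons c p)
  have "(\<lambda>x. x * poly p x) \<in> adjoin_x A invariants"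
    using pCons.IH unfolding adjoin_x_def by (intro generated_field.mult generated_field.generator[of "\<lambda>x. x"]) auto
  from add_in_adjoin_x[OF const_in_adjoin_x this] show ?case by (simp add: poly_pCons[abs_def])
qed

lemma rational_fun_in_adjoin_x:
  assumes "rational_fun f"
  shows "f \<in> adjoin_x A invariants"
proof -
  obtain p r where f: "f = (\<lambda>x. poly p x * inverse (poly r x))"
    using assms unfolding rational_fun_def by (auto simp: divide_inverse)
  show ?thesis using poly_in_adjoin_x unfolding f adjoin_x_def
    by (intro generated_field.mult generated_field.inverse)
qed

text \<open>The differential polynomial witnessing dependence is \<open>L(Y) - h\<close> with \<open>h = L(z)\<close>, where
  \<open>h - g\<close> is invariant.\<close>
theorem linear_relation_imp_dependent:
  assumes az: "\<forall>i\<in>{1..n}. rational_fun (a i) \<and> z i meromorphic_on A \<and>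
      (\<forall>\<^sub>\<approx>x\<in>A. z i (\<sigma> x) - z i x = a i x)"
    and L: "L \<in> linear_diff_polys n" "L \<noteq> 0" and g: "rational_fun g"
    and Lg: "\<forall>\<^sub>\<approx>x\<in>A. eval_linear_diff_poly \<delta> L a x = g (\<sigma> x) - g x"
  shows "diff_dependent A \<delta> (adjoin_x A invariants) n z"
proof -
  define h where "h = eval_linear_diff_poly \<delta> L z"
  define J where "J = Poly_Mapping.keys L"
  have finJ: "finite J" by (simp add: J_def)
  have J_sub: "J \<subseteq> {1..n} \<times> UNIV" using L(1) by (simp add: linear_diff_polys_def J_def)
  have h_mero: "h meromorphic_on A"
    unfolding h_def eval_linear_diff_poly_def[abs_def] case_prod_unfold
    using J_sub az by (intro meromorphic_on_sum meromorphic_on_mult meromorphic_on_const meromorphic_\<delta>_funpow)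
      (fastforce simp: J_def)
  have "\<forall>\<^sub>\<approx>x\<in>A. \<forall>(i, j)\<in>J. (\<delta> ^^ j) (z i) (\<sigma> x) - (\<delta> ^^ j) (z i) x = (\<delta> ^^ j) (a i) x"
    using J_sub az \<delta>_funpow_difference by (intro eventually_ball_finite finJ) fastforce
  \<comment> \<open>Since \<open>\<delta>\<close> commutes with the substitution, the difference of
    \<open>h = L(z)\<close> is \<open>L(a)\<close>, hence that of \<open>g\<close>; so
    \<open>h - g\<close> is invariant and \<open>h\<close> lies in the coefficient field.\<close>
  with Lg have "\<forall>\<^sub>\<approx>x\<in>A. h (\<sigma> x) - g (\<sigma> x) = h x - g x"
  proof eventually_elim
    case (elim x)
    have "h (\<sigma> x) - h x = eval_linear_diff_poly \<delta> L a x"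
      unfolding h_def eval_linear_diff_poly_def sum_subtractf[symmetric]
      using elim(2) by (intro sum.cong) (auto simp: J_def right_diff_distrib[symmetric])
    with elim(1) show ?case by (simp add: algebra_simps)
  qed
  moreover have g_mero: "g meromorphic_on A"
    using rational_fun_in_adjoin_x[OF g] by (rule adjoin_x_meromorphic)
  ultimately have "(\<lambda>x. h x - g x) \<in> invariants"
    using h_mero by (auto simp: invariants_def intro: meromorphic_intros)
  then have "(\<lambda>x. h x - g x) \<in> adjoin_x A invariants"
    unfolding adjoin_x_def by (intro generated_field.generator) simp
  from add_in_adjoin_x[OF this rational_fun_in_adjoin_x[OF g]]
  have h_in: "h \<in> adjoin_x A invariants" by simp
  have mh_in: "(\<lambda>x. 0 - h x) \<in> adjoin_x A invariants"
    using h_in const_in_adjoin_x[of 0] unfolding adjoin_x_def by (intro generated_field.diff)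
  \<comment> \<open>\<open>e k\<close> is the monomial consisting of the single variable indexed by
    \<open>k\<close>.\<close>
  define e where "e = (\<lambda>k :: nat \<times> nat. Poly_Mapping.single k (1 :: nat))"
  have keys_e: "Poly_Mapping.keys (e k) = {k}" for k by (simp add: e_def)
  have lookup_e: "Poly_Mapping.lookup (e k) k = 1" for k by (simp add: e_def)
  have inj_e: "inj_on e J" using keys_e by (intro inj_onI) (metis singleton_inject)
  have e_nz: "e k \<noteq> 0" for k using keys_e[of k] by auto
  define S where "S = insert 0 (e ` J)"
  define c where "c = (\<lambda>m. if m = 0 then (\<lambda>x. 0 - h x) else if m \<in> e ` J
    then (\<lambda>x. Poly_Mapping.lookup L (the_inv_into J e m)) else 0)"
  have c_e: "c (e k) = (\<lambda>x. Poly_Mapping.lookup L k)" if "k \<in> J" for k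
    using that e_nz inj_e by (simp add: c_def the_inv_into_f_f)
  define P where "P = Abs_poly_mapping c"
  have P: "Poly_Mapping.lookup P = c"
    unfolding P_def
  proof (rule lookup_Abs_poly_mapping, rule finite_subset)
    show "{m. c m \<noteq> 0} \<subseteq> S" by (auto simp: c_def S_def split: if_splits)
    show "finite S" using finJ by (simp add: S_def)
  qed
  have keys_P: "Poly_Mapping.keys P \<subseteq> S" by (auto simp: in_keys_iff P c_def S_def split: if_splits)
  have "P \<in> diff_polys (adjoin_x A invariants) n"
    unfolding diff_polys_def
  proof (intro CollectI ballI)
    fix m assume "m \<in> Poly_Mapping.keys P"
    then consider "m = 0" | k where "k \<in> J" "m = e k" using keys_P by (auto simp: S_def)
    then show "Poly_Mapping.lookup P m \<in> adjoin_x A invariants \<and> Poly_Mapping.keys m \<subseteq> {1..n} \<times> UNIV"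
    proof cases
      case 1
      then show ?thesis using mh_in by (simp add: P c_def)
    next
      case 2
      then show ?thesis using const_in_adjoin_x J_sub keys_e by (auto simp: P c_e)
    qed
  qed
  moreover have "diff_poly_nonzero A P"
  proof -
    \<comment> \<open>A linear coefficient of \<open>P\<close> is a nonzero constant, and the
      cosparse filter on the nonempty \<open>A\<close> is proper, so that coefficient is not almost
      everywhere zero.\<close>
    obtain k where k: "k \<in> J" using L(2) keys_eq_empty[of L] unfolding J_def by blast
    then have "Poly_Mapping.lookup L k \<noteq> 0" by (simp add: J_def in_keys_iff)
    moreover have "cosparse A \<noteq> bot" using uncountable_A by auto
    ultimately have "\<not> (\<forall>\<^sub>\<approx>x\<in>A. Poly_Mapping.lookup P (e k) x = 0)"
      using k by (simp add: P c_e eventually_const_iff)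
    then show ?thesis unfolding diff_poly_nonzero_def by blast
  qed
  moreover have "eval_diff_poly \<delta> P z x = 0" for x
  proof -
    let ?t = "\<lambda>m. c m x * (\<Prod>(i, j)\<in>Poly_Mapping.keys m. ((\<delta> ^^ j) (z i) x) ^ Poly_Mapping.lookup m (i, j))"
    have "eval_diff_poly \<delta> P z x = sum ?t (Poly_Mapping.keys P)"
      by (simp add: eval_diff_poly_def P)
    also have "\<dots> = sum ?t S"
      using finJ keys_P by (intro sum.mono_neutral_left) (auto simp: S_def in_keys_iff P)
    also have "\<dots> = ?t 0 + sum ?t (e ` J)"
      unfolding S_def using finJ e_nz by (intro sum.insert) (auto simp: image_iff dest: sym)
    also have "sum ?t (e ` J) = (\<Sum>k\<in>J. ?t (e k))"
      by (simp add: sum.reindex[OF inj_e])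
    also have "\<dots> = h x"
      unfolding h_def eval_linear_diff_poly_def J_def[symmetric]
      by (intro sum.cong) (auto simp: c_e keys_e lookup_e)
    also have "?t 0 = - h x" by (simp add: c_def)
    finally show ?thesis by simp
  qed
  ultimately show ?thesis unfolding diff_dependent_def by (intro bexI[of _ P]) auto
qed

theorem dependent_iff_linear_relation:
  assumes "\<forall>i\<in>{1..n}. rational_fun (a i) \<and> z i meromorphic_on A \<and>
      (\<forall>\<^sub>\<approx>x\<in>A. z i (\<sigma> x) - z i x = a i x)"
  shows "diff_dependent A \<delta> (adjoin_x A invariants) n z \<longleftrightarrow>
    (\<exists>L\<in>linear_diff_polys n. L \<noteq> 0 \<and> (\<exists>g. rational_fun g \<and>
      (\<forall>\<^sub>\<approx>x\<in>A. eval_linear_diff_poly \<delta> L a x = g (\<sigma> x) - g x)))"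
  using dependent_imp_linear_relation[OF assms] linear_relation_imp_dependent[OF assms] by blast

end

section \<open>The shift and the scaling as instances\<close>

lemma affine_difference_shift: "affine_difference UNIV 1 1 1"
proof
  show "inj (\<lambda>n. ((\<lambda>x. 1 * x + 1) ^^ n) x)" for x :: complex
  proof -
    have "((\<lambda>x. 1 * x + 1) ^^ n) x = x + of_nat n" for n by (induction n) auto
    then show ?thesis by (simp add: inj_def)
  qed
qed (auto simp: uncountable_UNIV_complex)

text \<open>As \<open>norm q\<close> is positive and different from 1, its powers are pairwise
  distinct, so the points \<open>q ^ n * x\<close> with \<open>x\<close> nonzero are distinct. The
  polynomial \<open>[:0, 1:]\<close> turns \<open>\<delta>\<close> into the Euler
  derivation.\<close>

lemma affine_difference_scaling:
  assumes "q \<noteq> 0" "norm q \<noteq> 1"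
  shows "affine_difference (- {0}) q 0 [:0, 1:]"
proof
  show "connected (- {0 :: complex})" by (intro connected_punctured_universe) simp
  show "uncountable (- {0 :: complex})"
    using uncountable_minus_countable[OF uncountable_UNIV_complex, of "{0}"] by (simp add: Compl_eq_Diff_UNIV)
  show "inj (\<lambda>n. ((\<lambda>x. q * x + 0) ^^ n) x)" if "x \<in> - {0}" for x
  proof (rule injI)
    have *: "((\<lambda>x. q * x + 0) ^^ n) x = q ^ n * x" for n by (induction n) auto
    fix m n assume "((\<lambda>x. q * x + 0) ^^ m) x = ((\<lambda>x. q * x + 0) ^^ n) x"
    then have "q ^ m = q ^ n" using that unfolding * by simp
    then have "norm q ^ m = norm q ^ n" by (metis norm_power)
    then show "m = n" using assms power_inject_exp'[of "norm q" m n] by simp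
  qed
qed (use assms in auto)

theorem corollary3p2:
  shows "(\<forall>(n :: nat) (a :: nat \<Rightarrow> complex \<Rightarrow> complex) (z :: nat \<Rightarrow> complex \<Rightarrow> complex).
      (\<forall>i\<in>{1..n}. rational_fun (a i) \<and> z i meromorphic_on UNIV \<and>
         (\<forall>\<^sub>\<approx>x\<in>UNIV. z i (x + 1) - z i x = a i x)) \<longrightarrow>
      (diff_dependent UNIV deriv (adjoin_x UNIV periodic_field) n z \<longleftrightarrow>
       (\<exists>L\<in>linear_diff_polys n. L \<noteq> 0 \<and>
          (\<exists>g. rational_fun g \<and>
             (\<forall>\<^sub>\<approx>x\<in>UNIV. eval_linear_diff_poly deriv L a x = g (x + 1) - g x)))))
    \<and>
    (\<forall>(q :: complex) (n :: nat) (a :: nat \<Rightarrow> complex \<Rightarrow> complex) (z :: nat \<Rightarrow> complex \<Rightarrow> complex).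
      q \<noteq> 0 \<and> norm q \<noteq> 1 \<and>
      (\<forall>i\<in>{1..n}. rational_fun (a i) \<and> z i meromorphic_on (- {0}) \<and>
         (\<forall>\<^sub>\<approx>x\<in>- {0}. z i (q * x) - z i x = a i x)) \<longrightarrow>
      (diff_dependent (- {0}) euler_deriv (adjoin_x (- {0}) (q_periodic_field q)) n z \<longleftrightarrow>
       (\<exists>L\<in>linear_diff_polys n. L \<noteq> 0 \<and>
          (\<exists>g. rational_fun g \<and>
             (\<forall>\<^sub>\<approx>x\<in>- {0}. eval_linear_diff_poly euler_deriv L a x = g (q * x) - g x)))))"
proof (intro conjI allI impI)
  fix n :: nat and a z :: "nat \<Rightarrow> complex \<Rightarrow> complex"
  assume az: "\<forall>i\<in>{1..n}. rational_fun (a i) \<and> z i meromorphic_on UNIV \<and>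
    (\<forall>\<^sub>\<approx>x\<in>UNIV. z i (x + 1) - z i x = a i x)"
  interpret affine_difference UNIV 1 1 1 by (rule affine_difference_shift)
  have \<sigma>: "\<sigma> x = x + 1" for x by (simp add: \<sigma>_def)
  have \<delta>: "\<delta> = deriv" by (simp add: \<delta>_def[abs_def])
  have inv: "invariants = periodic_field" by (simp add: invariants_def periodic_field_def \<sigma>)
  show "diff_dependent UNIV deriv (adjoin_x UNIV periodic_field) n z \<longleftrightarrow>
       (\<exists>L\<in>linear_diff_polys n. L \<noteq> 0 \<and>
          (\<exists>g. rational_fun g \<and>
             (\<forall>\<^sub>\<approx>x\<in>UNIV. eval_linear_diff_poly deriv L a x = g (x + 1) - g x)))"
    using dependent_iff_linear_relation[of n a z] az unfolding \<sigma> \<delta> inv by blast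
next
  fix q :: complex and n :: nat and a z :: "nat \<Rightarrow> complex \<Rightarrow> complex"
  assume az: "q \<noteq> 0 \<and> norm q \<noteq> 1 \<and>
      (\<forall>i\<in>{1..n}. rational_fun (a i) \<and> z i meromorphic_on (- {0}) \<and>
         (\<forall>\<^sub>\<approx>x\<in>- {0}. z i (q * x) - z i x = a i x))"
  then interpret affine_difference "- {0}" q 0 "[:0, 1:]"
    by (intro affine_difference_scaling) auto
  have \<sigma>: "\<sigma> x = q * x" for x by (simp add: \<sigma>_def)
  have \<delta>: "\<delta> = euler_deriv" by (simp add: \<delta>_def[abs_def] euler_deriv_def[abs_def])
  have inv: "invariants = q_periodic_field q"
    by (simp add: invariants_def q_periodic_field_def \<sigma>)
  show "diff_dependent (- {0}) euler_deriv (adjoin_x (- {0}) (q_periodic_field q)) n z \<longleftrightarrow>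
       (\<exists>L\<in>linear_diff_polys n. L \<noteq> 0 \<and>
          (\<exists>g. rational_fun g \<and>
             (\<forall>\<^sub>\<approx>x\<in>- {0}. eval_linear_diff_poly euler_deriv L a x = g (q * x) - g x)))"
    using dependent_iff_linear_relation[of n a z] az unfolding \<sigma> \<delta> inv by blast
qed

end
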